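(* Let $G$ be a finite simple undirected graph and $x\in V_G$. Then \[\operatorname{nlcw}(G)-1\le\operatorname{nlcw}(S(G,x))\le\operatorname{nlcw}(G)+1\quad\text{and}\quad \tfrac12\operatorname{cw}(G)\le\operatorname{cw}(S(G,x))\le 2\operatorname{cw}(G).\]
   Context: Switching: $S(G,x)$ has vertex set $V_G$ and edge set $E_G\setminus\{\{x,y\}:\{x,y\}\in E_G\}\cup\{\{x,y\}: y\in V_G,\ y\neq x,\ \{x,y\}\notin E_G\}$; i.e. the neighborhood of $x$ is replaced by its complement in $V_G\setminus\{x\}$, all other adjacencies unchanged. Clique-width: for a positive integer $k$, $\mathrm{CW}_k$ is the smallest class of graphs whose vertices carry labels from $\{1,\dots,k\}$ that contains every single-vertex graph with any label and is closed under: disjoint union; relabeling $\rho_{a\to b}$ for $a\neq b$; and $\eta_{a,b}$ for $a\neq b$ (add all edges between vertices labeled $a$ and vertices labeled $b$). $\operatorname{cw}(G)$ is the least $k$ such that some labeling of $G$ lies in $\mathrm{CW}_k$. NLC-width: $\mathrm{NLC}_k$ is the smallest class of labeled graphs (labels in $\{1,\dots,k\}$) containing every single-vertex graph with any label and closed under: $G\times_S J$ for $S\subseteq\{1,\dots,k\}^2$ (disjoint union of vertex-disjoint $G$ and $J$ plus all edges $\{u,v\}$, $u\in V_G$, $v\in V_J$, $(\mathrm{lab}(u),\mathrm{lab}(v))\in S$); and $\circ_R$ for $R:\{1,\dots,k\}\to\{1,\dots,k\}$. $\operatorname{nlcw}(G)$ is the least $k$ such that some labeling of $G$ lies in $\mathrm{NLC}_k$.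 *)

theory Defs
  imports Complex_Main "HOL-Library.FuncSet"
begin

record 'a graph =
  verts :: "'a set"
  edges :: "'a set set"

definition simple_graph :: "'a graph \<Rightarrow> bool" where
  "simple_graph G \<longleftrightarrow>
     finite (verts G) \<and> (\<forall>e\<in>edges G. e \<subseteq> verts G \<and> card e = 2)"

definition switching :: "'a graph \<Rightarrow> 'a \<Rightarrow> 'a graph" where
  "switching G x =
     \<lparr>verts = verts G,
      edges = (edges G - {{x, y} | y. {x, y} \<in> edges G})
        \<union> {{x, y} | y. y \<in> verts G \<and> y \<noteq> x \<and> {x, y} \<notin> edges G}\<rparr>"

text \<open>
  In a labelled graph only the values of the labelling on the vertices are meaningful.
\<close>

record 'a lgraph = "'a graph" +
  lab :: "'a \<Rightarrow> nat"

definition labelling :: "'a graph \<Rightarrow> ('a \<Rightarrow> nat) \<Rightarrow> 'a lgraph" where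
  "labelling G l = \<lparr>verts = verts G, edges = edges G, lab = l\<rparr>"

definition single_vertex :: "'a \<Rightarrow> nat \<Rightarrow> 'a lgraph" where
  "single_vertex v a = \<lparr>verts = {v}, edges = {}, lab = (\<lambda>_. a)\<rparr>"

definition disj_union :: "'a lgraph \<Rightarrow> 'a lgraph \<Rightarrow> 'a lgraph" where
  "disj_union G J =
     \<lparr>verts = verts G \<union> verts J,
      edges = edges G \<union> edges J,
      lab = (\<lambda>v. if v \<in> verts G then lab G v else lab J v)\<rparr>"

definition relabel :: "(nat \<Rightarrow> nat) \<Rightarrow> 'a lgraph \<Rightarrow> 'a lgraph" where
  "relabel R G = G\<lparr>lab := R \<circ> lab G\<rparr>"

definition add_edges :: "nat \<Rightarrow> nat \<Rightarrow> 'a lgraph \<Rightarrow> 'a lgraph" where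
  "add_edges a b G =
     G\<lparr>edges := edges G \<union>
       {{u, v} | u v. u \<in> verts G \<and> v \<in> verts G \<and> lab G u = a \<and> lab G v = b}\<rparr>"

definition nlc_join :: "(nat \<times> nat) set \<Rightarrow> 'a lgraph \<Rightarrow> 'a lgraph \<Rightarrow> 'a lgraph" where
  "nlc_join S G J =
     (disj_union G J)\<lparr>edges := edges G \<union> edges J \<union>
       {{u, v} | u v. u \<in> verts G \<and> v \<in> verts J \<and> (lab G u, lab J v) \<in> S}\<rparr>"

text \<open>
  All graphs have their vertices in a fixed type, and disjoint union is the actual union
  of graphs with disjoint vertex sets.  No closure under isomorphism is needed: every
  intermediate graph in a construction of \<open>G\<close> lives on a subset of the vertices of \<open>G\<close>.
\<close>

inductive_set CW :: "nat \<Rightarrow> 'a lgraph set" for k :: nat where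
  CW_vertex: "a \<in> {1..k} \<Longrightarrow> single_vertex v a \<in> CW k"
| CW_union: "\<lbrakk>G \<in> CW k; J \<in> CW k; verts G \<inter> verts J = {}\<rbrakk> \<Longrightarrow> disj_union G J \<in> CW k"
| CW_relabel: "\<lbrakk>G \<in> CW k; a \<in> {1..k}; b \<in> {1..k}; a \<noteq> b\<rbrakk>
    \<Longrightarrow> relabel (id(a := b)) G \<in> CW k"
| CW_add_edges: "\<lbrakk>G \<in> CW k; a \<in> {1..k}; b \<in> {1..k}; a \<noteq> b\<rbrakk>
    \<Longrightarrow> add_edges a b G \<in> CW k"

inductive_set NLC :: "nat \<Rightarrow> 'a lgraph set" for k :: nat where
  NLC_vertex: "a \<in> {1..k} \<Longrightarrow> single_vertex v a \<in> NLC k"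
| NLC_join: "\<lbrakk>G \<in> NLC k; J \<in> NLC k; verts G \<inter> verts J = {}; S \<subseteq> {1..k} \<times> {1..k}\<rbrakk>
    \<Longrightarrow> nlc_join S G J \<in> NLC k"
| NLC_relabel: "\<lbrakk>G \<in> NLC k; R \<in> {1..k} \<rightarrow> {1..k}\<rbrakk> \<Longrightarrow> relabel R G \<in> NLC k"

definition cw :: "'a graph \<Rightarrow> nat" where
  "cw G = (LEAST k. 1 \<le> k \<and> (\<exists>l. labelling G l \<in> CW k))"

definition nlcw :: "'a graph \<Rightarrow> nat" where
  "nlcw G = (LEAST k. 1 \<le> k \<and> (\<exists>l. labelling G l \<in> NLC k))"

end

(* For NLC-width, an expression for G is changed only along the path from the leaf x to the root:
   x carries a private new label, and since x is its only bearer, each join can connect x to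
   exactly those vertices to which the original join did not connect it.

   For clique-width, split every label i into i and i + k according to adjacency to x and build
   G - x.  At the end the labels collapse to the two classes "neighbour" and "non-neighbour" of x;
   if k > 1 there is then a spare label for x, and if k = 1 the graph has no edges, so the label
   for neighbours is itself free.

   As switching at x is an involution, the lower bounds follow from the upper bounds. *)
theory Submission
  imports Defs
begin

section \<open>Switching as an operation on edge sets\<close>

lemma edges_switching:
  assumes "\<forall>e\<in>edges G. card e = 2"
  shows "edges (switching G x) =
    {e \<in> edges G. x \<notin> e} \<union> {{x, y} | y. y \<in> verts G \<and> y \<noteq> x \<and> {x, y} \<notin> edges G}"
proof -
  have "\<exists>y. e = {x, y}" if "e \<in> edges G" "x \<in> e" for e
    using that assms[rule_format, OF that(1)] by (auto simp: card_2_iff)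
  then show ?thesis
    by (auto simp: switching_def)
qed

lemma verts_switching [simp]: "verts (switching G x) = verts G"
  by (simp add: switching_def)

lemma simple_graph_switching:
  assumes "simple_graph G" "x \<in> verts G"
  shows "simple_graph (switching G x)"
  using assms by (auto simp: simple_graph_def switching_def)

text \<open>Edges avoiding \<open>x\<close> are never touched, and the star at \<open>x\<close> is
  complemented twice. Simplicity puts every edge at \<open>x\<close> among the pairs
  \<open>{x, y}\<close> with \<open>y\<close> a vertex other than \<open>x\<close>, so the second
  complement restores exactly the old star.\<close>

lemma switching_switching:
  assumes "simple_graph G"
  shows "switching (switching G x) x = G"
proof -
  have G: "e \<subseteq> verts G" "card e = 2" if "e \<in> edges G" for e
    using assms that by (auto simp: simple_graph_def)
  have card: "\<forall>e\<in>edges G. card e = 2" "\<forall>e\<in>edges (switching G x). card e = 2"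
    using G by (auto simp: switching_def)
  have star: "\<exists>y. e = {x, y} \<and> y \<noteq> x \<and> y \<in> verts G" if "e \<in> edges G" "x \<in> e" for e
    using G[OF that(1)] that(2) by (auto simp: card_2_iff)
  have "edges (switching (switching G x) x) = edges G"
    unfolding edges_switching[OF card(2)] verts_switching
    unfolding edges_switching[OF card(1)]
    using star by (auto simp: doubleton_eq_iff)
  then show ?thesis
    by (intro graph.equality) auto
qed

lemma labelling_simps [simp]:
  "verts (labelling G l) = verts G" "edges (labelling G l) = edges G" "lab (labelling G l) = l"
  "graph.truncate (labelling G l) = G"
  by (simp_all add: labelling_def graph.truncate_def)


section \<open>NLC-width\<close>

text \<open>The bound covers \<open>v\<close> outside the vertex set too, because a single vertex
  has a constant label function. Hence label functions can later be compared as total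
  functions.\<close>

lemma NLC_lab: "H \<in> NLC k \<Longrightarrow> lab H v \<in> {1..k}"
  by (induction arbitrary: v rule: NLC.induct)
    (fastforce simp: single_vertex_def nlc_join_def disj_union_def relabel_def)+

lemma NLC_edges:
  "H \<in> NLC k \<Longrightarrow> e \<in> edges H \<Longrightarrow> e \<subseteq> verts H \<and> card e = 2"
proof (induction arbitrary: e rule: NLC.induct)
  case (NLC_join G J S)
  have "u \<noteq> v" if "u \<in> verts G" "v \<in> verts J" for u v
    using that NLC_join.hyps by auto
  with NLC_join show ?case
    by (fastforce simp: nlc_join_def disj_union_def)
qed (auto simp: single_vertex_def relabel_def)

lemma NLC_Suc: "H \<in> NLC k \<Longrightarrow> H \<in> NLC (Suc k)"
proof (induction rule: NLC.induct)
  case (NLC_vertex a v)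
  then show ?case by (intro NLC.NLC_vertex) auto
next
  case (NLC_join G J S)
  then show ?case by (intro NLC.NLC_join) auto
next
  case (NLC_relabel G R)
  \<comment> \<open>\<open>R\<close> is controlled only on \<open>{1..k}\<close>; fixing
    \<open>Suc k\<close> gives a map of \<open>{1..Suc k}\<close> into itself, and no vertex bears
    the changed label.\<close>
  have "relabel (R(Suc k := Suc k)) G \<in> NLC (Suc k)"
    using NLC_relabel by (intro NLC.NLC_relabel) (auto simp: Pi_iff le_Suc_eq)
  moreover have "R(Suc k := Suc k) \<circ> lab G = R \<circ> lab G"
  proof
    fix v
    show "(R(Suc k := Suc k) \<circ> lab G) v = (R \<circ> lab G) v"
      using NLC_lab[OF NLC_relabel.hyps(1), of v] by auto
  qed
  ultimately show ?case by (simp add: relabel_def)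
qed

text \<open>Switching at a vertex of the left part switches that part and negates the row of
  \<open>x\<close> in the cross adjacency; \<open>P u v \<noteq> (u = x)\<close> is an exclusive or.
  An abstract \<open>P\<close> lets the lemma also serve the right part, with the two sides
  exchanged.\<close>

lemma edges_switching_join:
  assumes "\<forall>e\<in>E. e \<subseteq> V \<and> card e = 2" "\<forall>e\<in>F. e \<subseteq> W \<and> card e = 2"
    and "V \<inter> W = {}" "x \<in> V"
  shows "edges (switching \<lparr>verts = V \<union> W,
        edges = E \<union> F \<union> {{u, v} | u v. u \<in> V \<and> v \<in> W \<and> P u v}\<rparr> x) =
      edges (switching \<lparr>verts = V, edges = E\<rparr> x) \<union> F \<union>
        {{u, v} | u v. u \<in> V \<and> v \<in> W \<and> P u v \<noteq> (u = x)}"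
proof -
  let ?M = "{{u, v} | u v. u \<in> V \<and> v \<in> W \<and> P u v}"
  let ?star = "\<lambda>U E. {{x, y} | y. y \<in> U \<and> y \<noteq> x \<and> {x, y} \<notin> E}"
  \<comment> \<open>The new cross edges fall into those avoiding \<open>x\<close>, which are kept
    (\<open>?N\<close>), and those at \<open>x\<close>, which are the missing old ones
    (\<open>?K\<close>).\<close>
  let ?N = "{{u, v} | u v. u \<in> V - {x} \<and> v \<in> W \<and> P u v}"
  let ?K = "{{x, v} | v. v \<in> W \<and> \<not> P x v}"
  have x: "x \<notin> W" and neq: "\<And>u v. u \<in> V \<Longrightarrow> v \<in> W \<Longrightarrow> u \<noteq> v"
    using assms(3,4) by auto
  have "card {u, v} = 2" if "u \<in> V" "v \<in> W" for u v
    using neq[OF that] by simp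
  then have cards: "\<forall>e\<in>E \<union> F \<union> ?M. card e = 2" "\<forall>e\<in>E. card e = 2"
    using assms(1,2) by auto
  \<comment> \<open>Adjacency to \<open>x\<close> in the joined graph is decided by \<open>E\<close>
    inside \<open>V\<close> and by \<open>P\<close> alone inside \<open>W\<close>.\<close>
  have V: "{x, y} \<in> E \<union> F \<union> ?M \<longleftrightarrow> {x, y} \<in> E" if "y \<in> V" for y
    using that neq x assms(2) by (auto simp: doubleton_eq_iff)
  have W: "{x, y} \<in> E \<union> F \<union> ?M \<longleftrightarrow> P x y" if "y \<in> W" for y
  proof -
    have "{x, y} \<notin> E" "{x, y} \<notin> F"
      using that neq[of y y] x assms(1,2) by blast+
    then show ?thesis
      using that neq[of _ y] x assms(4) by (auto simp: doubleton_eq_iff)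
  qed
  have "?star (V \<union> W) (E \<union> F \<union> ?M) = ?star V (E \<union> F \<union> ?M) \<union> ?star W (E \<union> F \<union> ?M)"
    by blast
  also have "?star V (E \<union> F \<union> ?M) = ?star V E"
    by (intro Collect_cong ex_cong1 conj_cong refl) (simp only: V)
  also have "?star W (E \<union> F \<union> ?M) = ?K"
    using x by (intro Collect_cong ex_cong1) (metis (no_types, lifting) W)
  finally have star: "?star (V \<union> W) (E \<union> F \<union> ?M) = ?star V E \<union> ?K" .
  have "{e \<in> F. x \<notin> e} = F"
    using x assms(2) by blast
  moreover have "{e \<in> ?M. x \<notin> e} = ?N"
    using x by auto
  ultimately have "{e \<in> E \<union> F \<union> ?M. x \<notin> e} = {e \<in> E. x \<notin> e} \<union> F \<union> ?N"
    by (simp only: Collect_conj_eq Collect_mem_eq Int_Un_distrib2)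
  moreover have "{{u, v} | u v. u \<in> V \<and> v \<in> W \<and> P u v \<noteq> (u = x)} = ?N \<union> ?K"
    using assms(4) by blast
  ultimately show ?thesis
    using star edges_switching[of "\<lparr>verts = V \<union> W, edges = E \<union> F \<union> ?M\<rparr>" x]
      edges_switching[of "\<lparr>verts = V, edges = E\<rparr>" x] cards
    by (simp only: graph.simps) blast
qed

text \<open>The clause on \<open>l\<close> is the induction invariant: the label
  \<open>Suc k\<close> belongs to \<open>x\<close> alone and all other vertices keep their labels,
  so the old join relations remain usable.\<close>

lemma NLC_switching:
  "H \<in> NLC k \<Longrightarrow> x \<in> verts H \<Longrightarrow>
    \<exists>l. labelling (switching (graph.truncate H) x) l \<in> NLC (Suc k) \<and>
      (\<forall>v\<in>verts H. l v = (if v = x then Suc k else lab H v))"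
proof (induction rule: NLC.induct)
  case (NLC_vertex a v)
  have "labelling (switching (graph.truncate (single_vertex v a)) x) (\<lambda>_. Suc k) =
      single_vertex v (Suc k)"
    using NLC_vertex.prems
    by (auto simp: labelling_def switching_def graph.truncate_def single_vertex_def)
  moreover have "single_vertex v (Suc k) \<in> NLC (Suc k)"
    by (rule NLC.NLC_vertex) simp
  ultimately show ?case
    using NLC_vertex.prems by (intro exI[of _ "\<lambda>_. Suc k"]) (simp add: single_vertex_def)
next
  case (NLC_join G J S)
  let ?H = "nlc_join S G J"
  have GJ: "\<forall>e\<in>edges G. e \<subseteq> verts G \<and> card e = 2" "\<forall>e\<in>edges J. e \<subseteq> verts J \<and> card e = 2"
    using NLC_join.hyps(1,2)[THEN NLC_edges] by auto
  have lab: "lab G v \<in> {1..k}" "lab J v \<in> {1..k}" for v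
    using NLC_join.hyps(1,2)[THEN NLC_lab] .
  have S: "(a, Suc k) \<notin> S" "(Suc k, b) \<notin> S" for a b
    using NLC_join.hyps(4) by auto
  have lab_neq: "lab G v \<noteq> Suc k" "lab J v \<noteq> Suc k" for v
    using lab[of v] by auto
  show ?case
  proof (cases "x \<in> verts G")
    case True
    then have xJ: "x \<notin> verts J" using NLC_join.hyps by auto
    let ?G = "switching (graph.truncate G) x"
    obtain l where l: "labelling ?G l \<in> NLC (Suc k)"
      "\<And>v. v \<in> verts G \<Longrightarrow> l v = (if v = x then Suc k else lab G v)"
      using NLC_join.IH(1)[OF True] by blast
    \<comment> \<open>The row of \<open>Suc k\<close> is the complement of the row of the former
      label of \<open>x\<close>. Other vertices with that label still follow
      \<open>S\<close>.\<close>
    define S' where "S' = S \<union> {(Suc k, b) | b. b \<in> {1..k} \<and> (lab G x, b) \<notin> S}"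
    let ?l = "\<lambda>v. if v \<in> verts G then l v else lab J v"
    have S'_iff: "(l u, lab J v) \<in> S' \<longleftrightarrow> ((lab G u, lab J v) \<in> S) \<noteq> (u = x)" if "u \<in> verts G" for u v
      using that lab lab_neq S by (auto simp: S'_def l(2))
    have "nlc_join S' (labelling ?G l) J \<in> NLC (Suc k)"
    proof (rule NLC.NLC_join[OF l(1) NLC_Suc[OF NLC_join.hyps(2)]])
      show "S' \<subseteq> {1..Suc k} \<times> {1..Suc k}"
        using NLC_join.hyps(4) by (auto simp: S'_def)
    qed (use NLC_join.hyps(3) in \<open>auto simp: labelling_def graph.truncate_def\<close>)
    moreover have "nlc_join S' (labelling ?G l) J = labelling (switching (graph.truncate ?H) x) ?l"
    proof -
      have "edges ?G \<union> edges J \<union>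
          {{u, v} | u v. u \<in> verts G \<and> v \<in> verts J \<and> ((lab G u, lab J v) \<in> S) \<noteq> (u = x)} =
          edges (switching (graph.truncate ?H) x)"
        using edges_switching_join[OF GJ NLC_join.hyps(3) True, of "\<lambda>u v. (lab G u, lab J v) \<in> S"]
        by (simp add: nlc_join_def disj_union_def graph.truncate_def)
      moreover have "{{u, v} | u v. u \<in> verts G \<and> v \<in> verts J \<and> (l u, lab J v) \<in> S'} =
          {{u, v} | u v. u \<in> verts G \<and> v \<in> verts J \<and> ((lab G u, lab J v) \<in> S) \<noteq> (u = x)}"
        using S'_iff by blast
      ultimately show ?thesis
        by (simp add: nlc_join_def disj_union_def labelling_def graph.truncate_def cong: if_cong)
    qed
    ultimately show ?thesis
      using True xJ l(2) by (intro exI[of _ ?l]) (auto simp: nlc_join_def disj_union_def)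
  next
    case False
    then have xJ: "x \<in> verts J"
      using NLC_join.prems by (auto simp: nlc_join_def disj_union_def)
    let ?J = "switching (graph.truncate J) x"
    obtain l where l: "labelling ?J l \<in> NLC (Suc k)"
      "\<And>v. v \<in> verts J \<Longrightarrow> l v = (if v = x then Suc k else lab J v)"
      using NLC_join.IH(2)[OF xJ] by blast
    \<comment> \<open>The mirror image: now a column is complemented.\<close>
    define S' where "S' = S \<union> {(a, Suc k) | a. a \<in> {1..k} \<and> (a, lab J x) \<notin> S}"
    let ?l = "\<lambda>v. if v \<in> verts G then lab G v else l v"
    have S'_iff: "(lab G u, l v) \<in> S' \<longleftrightarrow> ((lab G u, lab J v) \<in> S) \<noteq> (v = x)" if "v \<in> verts J" for u v
      using that lab lab_neq S by (auto simp: S'_def l(2))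
    have "nlc_join S' G (labelling ?J l) \<in> NLC (Suc k)"
    proof (rule NLC.NLC_join[OF NLC_Suc[OF NLC_join.hyps(1)] l(1)])
      show "S' \<subseteq> {1..Suc k} \<times> {1..Suc k}"
        using NLC_join.hyps(4) by (auto simp: S'_def)
    qed (use NLC_join.hyps(3) in \<open>auto simp: labelling_def graph.truncate_def\<close>)
    moreover have "nlc_join S' G (labelling ?J l) = labelling (switching (graph.truncate ?H) x) ?l"
    proof -
      have "edges G \<union> edges ?J \<union>
          {{u, v} | u v. u \<in> verts G \<and> v \<in> verts J \<and> ((lab G u, lab J v) \<in> S) \<noteq> (v = x)} =
          edges (switching (graph.truncate ?H) x)"
      proof -
        \<comment> \<open>Edges are unordered, so the cross edges may be read from \<open>J\<close>
          to \<open>G\<close>, which puts \<open>x\<close> on the left.\<close>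
        have swap: "{{u, v} | u v. u \<in> verts G \<and> v \<in> verts J \<and> Q u v} =
            {{v, u} | v u. v \<in> verts J \<and> u \<in> verts G \<and> Q u v}" for Q
          by (auto simp: insert_commute)
        have "verts J \<inter> verts G = {}" using NLC_join.hyps(3) by blast
        from edges_switching_join[OF GJ(2,1) this xJ, of "\<lambda>v u. (lab G u, lab J v) \<in> S"]
        show ?thesis
          unfolding swap
          by (simp add: nlc_join_def disj_union_def graph.truncate_def swap Un_commute)
      qed
      moreover have "{{u, v} | u v. u \<in> verts G \<and> v \<in> verts J \<and> (lab G u, l v) \<in> S'} =
          {{u, v} | u v. u \<in> verts G \<and> v \<in> verts J \<and> ((lab G u, lab J v) \<in> S) \<noteq> (v = x)}"
        using S'_iff by blast
      ultimately show ?thesis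
        by (simp add: nlc_join_def disj_union_def labelling_def graph.truncate_def cong: if_cong)
    qed
    ultimately show ?thesis
      using False xJ l(2) NLC_join.hyps(3)
      by (intro exI[of _ ?l]) (auto simp: nlc_join_def disj_union_def)
  qed
next
  case (NLC_relabel G R)
  \<comment> \<open>Fixing \<open>Suc k\<close> keeps the label of \<open>x\<close> private, as
    \<open>R\<close> sends the other labels into \<open>{1..k}\<close>.\<close>
  let ?R = "R(Suc k := Suc k)"
  let ?G = "switching (graph.truncate G) x"
  obtain l where l: "labelling ?G l \<in> NLC (Suc k)"
    "\<And>v. v \<in> verts G \<Longrightarrow> l v = (if v = x then Suc k else lab G v)"
    using NLC_relabel by (auto simp: relabel_def)
  have "relabel ?R (labelling ?G l) \<in> NLC (Suc k)"
    using NLC_relabel.hyps(2) by (intro NLC.NLC_relabel[OF l(1)]) (auto simp: Pi_iff le_Suc_eq)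
  moreover have "lab G v \<noteq> Suc k" for v
    using NLC_lab[OF NLC_relabel.hyps(1), of v] by auto
  ultimately show ?case
    using l(2)
    by (intro exI[of _ "?R \<circ> l"])
      (auto simp: relabel_def labelling_def graph.truncate_def o_def fun_upd_def)
qed


section \<open>Clique-width\<close>

lemma CW_lab: "H \<in> CW k \<Longrightarrow> lab H v \<in> {1..k}"
  by (induction arbitrary: v rule: CW.induct)
    (auto simp: single_vertex_def disj_union_def relabel_def add_edges_def)

text \<open>Used to see that a graph with no vertex besides \<open>x\<close> has no edge avoiding
  \<open>x\<close>.\<close>

lemma CW_edges: "H \<in> CW k \<Longrightarrow> e \<in> edges H \<Longrightarrow> e \<noteq> {} \<and> e \<subseteq> verts H"
  by (induction arbitrary: e rule: CW.induct)
    (fastforce simp: single_vertex_def disj_union_def relabel_def add_edges_def)+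

text \<open>Edges arise only between two distinct labels.\<close>

lemma CW_1_edges: "H \<in> CW k \<Longrightarrow> k \<le> 1 \<Longrightarrow> edges H = {}"
  by (induction rule: CW.induct)
    (auto simp: single_vertex_def disj_union_def relabel_def add_edges_def)

text \<open>
  The label function of a member of \<open>CW k\<close> is determined by its construction outside the vertex
  set, too, so that \<open>CW k\<close> is not closed under changing those irrelevant values.  This predicate is.
\<close>

definition cw_built :: "nat \<Rightarrow> 'a set \<Rightarrow> 'a set set \<Rightarrow> ('a \<Rightarrow> nat) \<Rightarrow> bool" where
  "cw_built k V E l \<longleftrightarrow>
     (\<exists>l'. \<lparr>verts = V, edges = E, lab = l'\<rparr> \<in> CW k \<and> (\<forall>v\<in>V. l' v = l v))"

lemma cw_built_cong:
  "cw_built k V E l \<Longrightarrow> (\<And>v. v \<in> V \<Longrightarrow> l v = m v) \<Longrightarrow> cw_built k V E m"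
  by (auto simp: cw_built_def)

lemma cw_built_vertex: "l v \<in> {1..k} \<Longrightarrow> cw_built k {v} {} l"
  using CW_vertex[of "l v" k v] by (auto simp: cw_built_def single_vertex_def)

lemma cw_built_union:
  assumes "cw_built k V E l" "cw_built k W F l" "V \<inter> W = {}"
  shows "cw_built k (V \<union> W) (E \<union> F) l"
proof -
  from assms obtain l1 l2
    where 1: "\<lparr>verts = V, edges = E, lab = l1\<rparr> \<in> CW k" "\<forall>v\<in>V. l1 v = l v"
      and 2: "\<lparr>verts = W, edges = F, lab = l2\<rparr> \<in> CW k" "\<forall>v\<in>W. l2 v = l v"
    by (auto simp: cw_built_def)
  from CW_union[OF 1(1) 2(1)] assms(3) 1(2) 2(2) show ?thesis
    unfolding cw_built_def disj_union_def
    by (intro exI[of _ "\<lambda>v. if v \<in> V then l1 v else l2 v"]) (auto cong: if_cong)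
qed

lemma cw_built_relabel:
  assumes "cw_built k V E l" "a \<in> {1..k}" "b \<in> {1..k}"
  shows "cw_built k V E (\<lambda>v. if l v = a then b else l v)"
proof (cases "a = b")
  case True
  then show ?thesis using assms(1) by (auto elim: cw_built_cong)
next
  case False
  from assms(1) obtain l'
    where l': "\<lparr>verts = V, edges = E, lab = l'\<rparr> \<in> CW k" "\<forall>v\<in>V. l' v = l v"
    by (auto simp: cw_built_def)
  from CW_relabel[OF l'(1) assms(2,3) False] l'(2) show ?thesis
    unfolding cw_built_def relabel_def by (intro exI[of _ "id(a := b) \<circ> l'"]) auto
qed

text \<open>One label is merged into \<open>b\<close> at a time; vertices already merged bear
  \<open>b\<close> and stay there, even when the next label is \<open>b\<close> itself.\<close>

lemma cw_built_relabel_set: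
  assumes "cw_built k V E l" "A \<subseteq> {1..k}" "b \<in> {1..k}"
  shows "cw_built k V E (\<lambda>v. if l v \<in> A then b else l v)"
proof -
  have "finite A" using assms(2) finite_subset by blast
  then show ?thesis using assms(2)
  proof (induction A rule: finite_induct)
    case empty
    then show ?case using assms(1) by simp
  next
    case (insert a A)
    then have "cw_built k V E (\<lambda>v. if l v \<in> A then b else l v)" by simp
    from cw_built_relabel[OF this _ assms(3), of a] insert.prems show ?case
      by (auto elim: cw_built_cong)
  qed
qed

lemma cw_built_add_edges:
  assumes "cw_built k V E l" "a \<in> {1..k}" "b \<in> {1..k}" "a \<noteq> b"
  shows "cw_built k V (E \<union> {{u, v} | u v. u \<in> V \<and> v \<in> V \<and> l u = a \<and> l v = b}) l"
proof -
  from assms(1) obtain l'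
    where l': "\<lparr>verts = V, edges = E, lab = l'\<rparr> \<in> CW k" "\<forall>v\<in>V. l' v = l v"
    by (auto simp: cw_built_def)
  have "{{u, v} | u v. u \<in> V \<and> v \<in> V \<and> l u = a \<and> l v = b} =
      {{u, v} | u v. u \<in> V \<and> v \<in> V \<and> l' u = a \<and> l' v = b}"
    using l'(2) by (metis (no_types, opaque_lifting))
  with CW_add_edges[OF l'(1) assms(2-4)] l'(2) show ?thesis
    by (auto simp: cw_built_def add_edges_def)
qed

abbreviation split_lab :: "nat \<Rightarrow> 'a set \<Rightarrow> ('a \<Rightarrow> nat) \<Rightarrow> 'a \<Rightarrow> nat" where
  "split_lab k N l \<equiv> \<lambda>v. if v \<in> N then l v + k else l v"

text \<open>\<open>N\<close> is fixed in advance, so each vertex is created in its final half of the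
  labels, and every operation is imitated on both copies of the labels involved. The remaining
  vertex set must be nonempty because no expression builds the empty graph.\<close>

lemma cw_built_split:
  "H \<in> CW k \<Longrightarrow> verts H - {x} \<noteq> {} \<Longrightarrow>
    cw_built (2 * k) (verts H - {x}) {e \<in> edges H. x \<notin> e} (split_lab k N (lab H))"
proof (induction rule: CW.induct)
  case (CW_vertex a v)
  then have "v \<noteq> x" by (auto simp: single_vertex_def split: if_splits)
  then show ?case
    using CW_vertex.hyps cw_built_vertex[of "split_lab k N (\<lambda>_. a)" v "2 * k"]
    by (auto simp: single_vertex_def cong: if_cong)
next
  case (CW_union G J)
  let ?H = "disj_union G J"
  let ?l = "split_lab k N (lab ?H)"
  have no_edges: "{e \<in> edges K. x \<notin> e} = {}" if "K \<in> CW k" "verts K - {x} = {}" for K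
    using CW_edges[OF that(1)] that(2) by blast
  have H: "verts ?H - {x} = (verts G - {x}) \<union> (verts J - {x})"
    "{e \<in> edges ?H. x \<notin> e} = {e \<in> edges G. x \<notin> e} \<union> {e \<in> edges J. x \<notin> e}"
    by (auto simp: disj_union_def)
  have G: "cw_built (2 * k) (verts G - {x}) {e \<in> edges G. x \<notin> e} ?l" if "verts G - {x} \<noteq> {}"
    by (rule cw_built_cong[OF CW_union.IH(1)[OF that]]) (auto simp: disj_union_def)
  have J: "cw_built (2 * k) (verts J - {x}) {e \<in> edges J. x \<notin> e} ?l" if "verts J - {x} \<noteq> {}"
    by (rule cw_built_cong[OF CW_union.IH(2)[OF that]])
      (use CW_union.hyps(3) in \<open>auto simp: disj_union_def\<close>)
  \<comment> \<open>A side that vanishes with \<open>x\<close> is dropped, and the other side alone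
    is the result.\<close>
  consider "verts G - {x} = {}" | "verts J - {x} = {}" |
    "verts G - {x} \<noteq> {}" "verts J - {x} \<noteq> {}" by blast
  then show ?case
  proof cases
    case 1
    then show ?thesis
      using J CW_union.prems no_edges[OF CW_union.hyps(1) 1] unfolding H by (simp only: Un_empty_left simp_thms)
  next
    case 2
    then show ?thesis
      using G CW_union.prems no_edges[OF CW_union.hyps(2) 2] unfolding H by (simp only: Un_empty_right simp_thms)
  next
    case 3
    show ?thesis unfolding H
      using cw_built_union[OF G[OF 3(1)] J[OF 3(2)]] CW_union.hyps(3) by blast
  qed
next
  case (CW_relabel G a b)
  let ?G = "relabel (id(a := b)) G"
  have "cw_built (2 * k) (verts G - {x}) {e \<in> edges G. x \<notin> e} (split_lab k N (lab G))"
    using CW_relabel by (simp add: relabel_def)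
  \<comment> \<open>The two relabellings do not interfere: \<open>a\<close> and \<open>b\<close> are
    at most \<open>k\<close>, while \<open>a + k\<close> and \<open>b + k\<close> exceed
    \<open>k\<close>.\<close>
  from cw_built_relabel[OF cw_built_relabel[OF this, of a b], of "a + k" "b + k"]
  have "cw_built (2 * k) (verts G - {x}) {e \<in> edges G. x \<notin> e} (split_lab k N (lab ?G))"
  proof (rule cw_built_cong)
    fix v
    show "(if (if split_lab k N (lab G) v = a then b else split_lab k N (lab G) v) = a + k then b + k
       else if split_lab k N (lab G) v = a then b else split_lab k N (lab G) v) = split_lab k N (lab ?G) v"
      using CW_lab[OF CW_relabel.hyps(1), of v] CW_relabel.hyps(2-4) by (auto simp: relabel_def)
  qed (use CW_relabel.hyps in auto)
  then show ?case by (simp add: relabel_def)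
next
  case (CW_add_edges G a b)
  let ?l = "split_lab k N (lab G)" and ?V = "verts G - {x}"
  let ?F = "\<lambda>a b. {{u, v} | u v. u \<in> ?V \<and> v \<in> ?V \<and> ?l u = a \<and> ?l v = b}"
  have ab: "a \<in> {1..2 * k}" "b \<in> {1..2 * k}" "a + k \<in> {1..2 * k}" "b + k \<in> {1..2 * k}"
    "a \<noteq> b" "a \<noteq> b + k" "a + k \<noteq> b" "a + k \<noteq> b + k"
    using CW_add_edges.hyps by auto
  have "cw_built (2 * k) ?V {e \<in> edges G. x \<notin> e} ?l"
    using CW_add_edges by (simp add: add_edges_def)
  \<comment> \<open>Each of the two labels has two copies, so one operation becomes four, chained
    one after another.\<close>
  note cw_built_add_edges[OF this ab(1,2,5)]
  note cw_built_add_edges[OF this ab(1,4,6)]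
  note cw_built_add_edges[OF this ab(3,2,7)]
  note built = cw_built_add_edges[OF this ab(3,4,8)]
  have l: "(?l u = a \<or> ?l u = a + k) \<longleftrightarrow> lab G u = a" "(?l u = b \<or> ?l u = b + k) \<longleftrightarrow> lab G u = b" for u
    using CW_lab[OF CW_add_edges.hyps(1), of u] CW_add_edges.hyps(2,3) by auto
  have "?F a b \<union> ?F a (b + k) \<union> ?F (a + k) b \<union> ?F (a + k) (b + k) =
      {{u, v} | u v. u \<in> ?V \<and> v \<in> ?V \<and> (?l u = a \<or> ?l u = a + k) \<and> (?l v = b \<or> ?l v = b + k)}"
    by blast
  also have "\<dots> = {{u, v} | u v. u \<in> ?V \<and> v \<in> ?V \<and> lab G u = a \<and> lab G v = b}"
    unfolding l ..
  finally have "?F a b \<union> ?F a (b + k) \<union> ?F (a + k) b \<union> ?F (a + k) (b + k) =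
      {{u, v} | u v. u \<in> ?V \<and> v \<in> ?V \<and> lab G u = a \<and> lab G v = b}" .
  moreover have "{e \<in> edges (add_edges a b G). x \<notin> e} = {e \<in> edges G. x \<notin> e} \<union>
      {{u, v} | u v. u \<in> ?V \<and> v \<in> ?V \<and> lab G u = a \<and> lab G v = b}"
    by (auto simp: add_edges_def)
  ultimately have F: "{e \<in> edges G. x \<notin> e} \<union> ?F a b \<union> ?F a (b + k) \<union> ?F (a + k) b \<union> ?F (a + k) (b + k) =
      {e \<in> edges (add_edges a b G). x \<notin> e}"
    by (simp only: Un_assoc)
  show ?case
    using built unfolding F by (simp add: add_edges_def cong: if_cong)
qed

lemma CW_switching:
  assumes G: "simple_graph G" "x \<in> verts G" and k: "labelling G l \<in> CW k" "1 \<le> k"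
  shows "\<exists>l'. labelling (switching G x) l' \<in> CW (2 * k)"
proof -
  let ?V = "verts G - {x}" and ?E = "{e \<in> edges G. x \<notin> e}"
  define N where "N = {y. {x, y} \<in> edges G}"
  \<comment> \<open>The final labels. For \<open>k = 1\<close> the values \<open>2\<close> and
    \<open>Suc k\<close> coincide, but then \<open>N\<close> is empty; for larger \<open>k\<close>
    they differ.\<close>
  define m where "m v = (if v = x then 2 else if v \<in> N then Suc k else 1)" for v
  have l: "1 \<le> l v" "l v \<le> k" for v
    using CW_lab[OF k(1), of v] by (auto simp: labelling_def)
  have N: "N = {}" if "k = 1"
    using CW_1_edges[OF k(1)] that by (auto simp: N_def labelling_def)
  have E: "edges (switching G x) = ?E \<union> {{x, y} | y. y \<in> verts G \<and> y \<noteq> x \<and> {x, y} \<notin> edges G}"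
    using G(1) by (intro edges_switching) (auto simp: simple_graph_def)
  have x: "cw_built (2 * k) {x} {} m"
    using k(2) by (intro cw_built_vertex) (auto simp: m_def)
  have built: "cw_built (2 * k) (verts G) ?E m"
  proof (cases "?V = {}")
    case True
    \<comment> \<open>Here \<open>G\<close> is the single vertex \<open>x\<close>, which is built
      directly since splitting needs a remaining vertex.\<close>
    have "e = {}" if "e \<in> ?E" for e
      using that G(1) True by (auto simp: simple_graph_def)
    moreover have "{} \<notin> edges G"
      using G(1) by (auto simp: simple_graph_def)
    ultimately have "?E = {}" by blast
    moreover have "verts G = {x}" using True G(2) by auto
    ultimately show ?thesis using x by (simp only:)
  next
    case False
    then have "cw_built (2 * k) ?V ?E (split_lab k N l)"
      using cw_built_split[OF k(1), of x N] by (simp add: labelling_def cong: if_cong)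
    \<comment> \<open>Non-neighbours collapse to \<open>1\<close>, then neighbours to
      \<open>Suc k\<close>; the value \<open>1\<close> lies below the second range and
      survives.\<close>
    note cw_built_relabel_set[OF this, of "{1..k}" 1]
    note cw_built_relabel_set[OF this, of "{Suc k..2 * k}" "Suc k"]
    then have "cw_built (2 * k) ?V ?E m"
    proof (rule cw_built_cong)
      fix v assume "v \<in> ?V"
      then show "(if (if split_lab k N l v \<in> {1..k} then 1 else split_lab k N l v) \<in> {Suc k..2 * k}
          then Suc k else if split_lab k N l v \<in> {1..k} then 1 else split_lab k N l v) = m v"
        using l[of v] k(2) by (auto simp: m_def)
    qed (use k(2) in auto)
    from cw_built_union[OF this x] G(2) show ?thesis
      by (simp add: insert_absorb)
  qed
  \<comment> \<open>Therefore a single edge addition between labels \<open>1\<close> and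
    \<open>2\<close> produces exactly the complemented star at \<open>x\<close>.\<close>
  have "m v = 2 \<longleftrightarrow> v = x" "m v = 1 \<longleftrightarrow> v \<noteq> x \<and> v \<notin> N" for v
    using N k(2) by (auto simp: m_def)
  then have "{{u, v} | u v. u \<in> verts G \<and> v \<in> verts G \<and> m u = 1 \<and> m v = 2} =
      {{x, y} | y. y \<in> verts G \<and> y \<noteq> x \<and> {x, y} \<notin> edges G}"
    using G(2) by (auto simp: N_def insert_commute)
  with cw_built_add_edges[OF built, of 1 2] k(2)
  have "cw_built (2 * k) (verts G) (edges (switching G x)) m"
    unfolding E by simp
  then show ?thesis
    by (auto simp: cw_built_def labelling_def)
qed


section \<open>Minimal widths\<close>

text \<open>
  If no \<open>k\<close> satisfies \<open>P\<close>, then none satisfies \<open>Q\<close> and both minima are the same junk value.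
\<close>

lemma Least_le_transfer:
  fixes P Q :: "nat \<Rightarrow> bool"
  assumes "\<And>k. P k \<Longrightarrow> Q (f k)" "\<And>k. Q k \<Longrightarrow> P (f k)" "\<And>k. k \<le> f k"
  shows "(LEAST k. Q k) \<le> f (LEAST k. P k)"
proof (cases "\<exists>k. P k")
  case True
  then have "P (LEAST k. P k)" by (rule LeastI_ex)
  then show ?thesis by (intro Least_le assms(1))
next
  case False
  then have "P = Q" using assms(2) by blast
  then show ?thesis using assms(3) by simp
qed

lemma nlcw_switching_le:
  assumes "simple_graph G" "x \<in> verts G"
  shows "nlcw (switching G x) \<le> Suc (nlcw G)"
proof -
  \<comment> \<open>Stated for any \<open>K\<close> because both directions of the transfer are
    required: it is applied to \<open>G\<close> and to its switching, whose own switching is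
    \<open>G\<close> again.\<close>
  have step: "\<exists>l. labelling (switching K x) l \<in> NLC (Suc k)"
    if "x \<in> verts K" "\<exists>l. labelling K l \<in> NLC k" for K :: "'a graph" and k
  proof -
    from that(2) obtain l where "labelling K l \<in> NLC k" ..
    from NLC_switching[OF this, of x] that(1) show ?thesis
      by auto
  qed
  show ?thesis
    unfolding nlcw_def
    by (rule Least_le_transfer)
      (use assms step[of G] step[of "switching G x"] switching_switching[OF assms(1), of x] in auto)
qed

lemma cw_switching_le:
  assumes "simple_graph G" "x \<in> verts G"
  shows "cw (switching G x) \<le> 2 * cw G"
  unfolding cw_def
proof (rule Least_le_transfer)
  note S = simple_graph_switching[OF assms]
  show "1 \<le> 2 * k \<and> (\<exists>l. labelling (switching G x) l \<in> CW (2 * k))"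
    if "1 \<le> k \<and> (\<exists>l. labelling G l \<in> CW k)" for k
    using that CW_switching[OF assms] by auto
  show "1 \<le> 2 * k \<and> (\<exists>l. labelling G l \<in> CW (2 * k))"
    if "1 \<le> k \<and> (\<exists>l. labelling (switching G x) l \<in> CW k)" for k
    using that CW_switching[OF S, of x] assms(2) by (auto simp: switching_switching[OF assms(1)])
qed simp

theorem theorem6:
  fixes G :: "'a graph" and x :: 'a
  assumes "simple_graph G" and "x \<in> verts G"
  shows "real (nlcw G) - 1 \<le> real (nlcw (switching G x)) \<and>
         real (nlcw (switching G x)) \<le> real (nlcw G) + 1 \<and>
         1 / 2 * real (cw G) \<le> real (cw (switching G x)) \<and>
         real (cw (switching G x)) \<le> 2 * real (cw G)"
proof -
  let ?S = "switching G x"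
  have S: "simple_graph ?S" "x \<in> verts ?S" "switching ?S x = G"
    using assms simple_graph_switching switching_switching by auto
  have "nlcw ?S \<le> Suc (nlcw G)" "nlcw G \<le> Suc (nlcw ?S)"
    "cw ?S \<le> 2 * cw G" "cw G \<le> 2 * cw ?S"
    using nlcw_switching_le[OF assms] nlcw_switching_le[OF S(1,2)]
      cw_switching_le[OF assms] cw_switching_le[OF S(1,2)] unfolding S(3) by auto
  then show ?thesis by linarith
qed

end
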